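(* Let $r=(0,x,x,x)^T$ with $x$ a positive integer, let $W_n$ be the set of elements of the triangle group $T$ of word length at most $n$ in the generators $S_1,\dots,S_4$, and let $W_nr=\{wr: w\in W_n\}$. Then there are constants $c_1,c_2>0$ such that $c_1\lambda^n/n^2\le |W_nr|\le c_2\lambda^n$ for all $n\ge1$, where $\lambda=\frac{1+\sqrt{13}}{2}$.
   Context: The triangle group $T\subset GL(4,\mathbb{Z})$ is generated by $S_1=\begin{pmatrix}-1&1&1&1\\0&1&0&0\\0&0&1&0\\0&0&0&1\end{pmatrix}$, $S_2=\begin{pmatrix}1&0&0&0\\1&-1&1&1\\0&0&1&0\\0&0&0&1\end{pmatrix}$, $S_3=\begin{pmatrix}1&0&0&0\\0&1&0&0\\1&1&-1&1\\0&0&0&1\end{pmatrix}$, $S_4=\begin{pmatrix}1&0&0&0\\0&1&0&0\\0&0&1&0\\1&1&1&-1\end{pmatrix}$, acting on column vectors. *)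

theory Defs
  imports "HOL-Analysis.Analysis" "HOL-Algebra.Generated_Groups"
begin

definition word_length :: "('a, 'b) monoid_scheme \<Rightarrow> 'a set \<Rightarrow> 'a \<Rightarrow> nat" where
  "word_length G X w =
     (LEAST k. \<exists>ws. set ws \<subseteq> X \<union> m_inv G ` X \<and> length ws = k \<and> foldr (mult G) ws (one G) = w)"

definition GL4Z :: "(int^4^4) monoid" where
  "GL4Z = \<lparr>carrier = {A. invertible A}, mult = (**), one = mat 1\<rparr>"

definition S1 :: "int^4^4" where
  "S1 = vector [vector [-1, 1, 1, 1],
                vector [ 0, 1, 0, 0],
                vector [ 0, 0, 1, 0],
                vector [ 0, 0, 0, 1]]"

definition S2 :: "int^4^4" where
  "S2 = vector [vector [ 1, 0, 0, 0],
                vector [ 1,-1, 1, 1],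
                vector [ 0, 0, 1, 0],
                vector [ 0, 0, 0, 1]]"

definition S3 :: "int^4^4" where
  "S3 = vector [vector [ 1, 0, 0, 0],
                vector [ 0, 1, 0, 0],
                vector [ 1, 1,-1, 1],
                vector [ 0, 0, 0, 1]]"

definition S4 :: "int^4^4" where
  "S4 = vector [vector [ 1, 0, 0, 0],
                vector [ 0, 1, 0, 0],
                vector [ 0, 0, 1, 0],
                vector [ 1, 1, 1,-1]]"

definition triangle_generators :: "(int^4^4) set" where
  "triangle_generators = {S1, S2, S3, S4}"

definition triangle_group :: "(int^4^4) set" where
  "triangle_group = generate GL4Z triangle_generators"

definition word_ball :: "nat \<Rightarrow> (int^4^4) set" where
  "word_ball n = {w \<in> triangle_group. word_length GL4Z triangle_generators w \<le> n}"

lemma group_GL4Z: "group GL4Z"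
proof (rule groupI)
  fix A assume "A \<in> carrier GL4Z"
  then obtain B where "A ** B = mat 1" "B ** A = mat 1"
    by (auto simp: GL4Z_def invertible_def)
  then show "\<exists>B\<in>carrier GL4Z. B \<otimes>\<^bsub>GL4Z\<^esub> A = \<one>\<^bsub>GL4Z\<^esub>"
    by (auto simp: GL4Z_def invertible_def)
qed (auto simp: GL4Z_def invertible_mult matrix_mul_assoc invertible_def[of "mat 1"])

lemma vector_4_nth:
  "(vector [a, b, c, d] :: 'a::zero^4) $ 1 = a"
  "(vector [a, b, c, d] :: 'a::zero^4) $ 2 = b"
  "(vector [a, b, c, d] :: 'a::zero^4) $ 3 = c"
  "(vector [a, b, c, d] :: 'a::zero^4) $ 4 = d"
  by (simp_all add: vector_def)

lemma triangle_generators_involution: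
  "S1 ** S1 = mat 1" "S2 ** S2 = mat 1" "S3 ** S3 = mat 1" "S4 ** S4 = mat 1"
  by (simp_all add: S1_def S2_def S3_def S4_def vec_eq_iff forall_4
      matrix_matrix_mult_def sum_4 vector_4_nth mat_def)

lemma triangle_generators_GL4Z: "triangle_generators \<subseteq> carrier GL4Z"
  using triangle_generators_involution
  by (auto simp: triangle_generators_def GL4Z_def invertible_def)

end

theory Submission
  imports Defs
begin

text \<open>
  The generator \<open>S\<^sub>i\<close> lowers the coordinate \<open>i\<close> of a vector by its excess
  \<open>2 p\<^sub>i - (\<Sum>j\<noteq>i. p\<^sub>j)\<close>, so each \<open>i\<close> is an ascent, a neutral or a descent of \<open>p\<close>
  according to the sign of the excess. Grade the orbit of \<open>r\<close> by the number of ascending steps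
  from \<open>r\<close>. The relation \<open>S\<^sub>i S\<^sub>j S\<^sub>i = S\<^sub>j S\<^sub>i S\<^sub>j\<close> shows that every descent leads exactly one level
  down, so the levels are disjoint and \<open>W\<^sub>n r\<close> is the union of the levels up to \<open>n\<close>.
  Double counting ascents against descents one level up, pairs of ascents against
  pairs of descents three levels up, and ascents paired with neutrals against neutrals paired with
  descents two levels up gives \<open>s (n + 2) = s (n + 1) + 3 * s n\<close> for the level sizes \<open>s n\<close>,
  \<open>n \<ge> 1\<close>. As \<open>\<lambda>\<^sup>2 = \<lambda> + 3\<close>, both \<open>s n\<close> and \<open>|W\<^sub>n r|\<close> are of exact order \<open>\<lambda>\<^sup>n\<close>.
\<close>

section \<open>Excesses, reflections and the braid relation\<close>

text \<open>Subtracting the full coordinate sum from \<open>3 * p $ i\<close> makes a reflection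
  change the second term equally for all indices.\<close>

definition excess :: "int^4 \<Rightarrow> 4 \<Rightarrow> int" where
  "excess p i = 3 * p $ i - (\<Sum>j\<in>UNIV. p $ j)"

definition reflect :: "4 \<Rightarrow> int^4 \<Rightarrow> int^4" where
  "reflect i p = (\<chi> k. if k = i then p $ k - excess p i else p $ k)"

lemma reflect_nth: "reflect i p $ k = (if k = i then p $ k - excess p i else p $ k)"
  by (simp add: reflect_def)

lemma sum_reflect: "(\<Sum>j\<in>UNIV. reflect i p $ j) = (\<Sum>j\<in>UNIV. p $ j) - excess p i"
proof -
  have "(\<Sum>j\<in>UNIV. reflect i p $ j) = (\<Sum>j\<in>UNIV. p $ j - (if j = i then excess p i else 0))"
    by (rule sum.cong) (auto simp: reflect_nth)
  then show ?thesis
    by (simp add: sum_subtractf)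
qed

lemma excess_reflect_same [simp]: "excess (reflect i p) i = - excess p i"
  using sum_reflect[of i p] by (simp add: excess_def reflect_nth)

lemma excess_reflect_other [simp]: "j \<noteq> i \<Longrightarrow> excess (reflect i p) j = excess p j + excess p i"
  using sum_reflect[of i p] by (simp add: excess_def reflect_nth)

lemma reflect_reflect [simp]: "reflect i (reflect i p) = p"
  by (simp add: vec_eq_iff reflect_nth)

lemma reflect_neutral: "excess p i = 0 \<Longrightarrow> reflect i p = p"
  by (simp add: vec_eq_iff reflect_nth)

text \<open>Both sides lower the coordinates \<open>i\<close> and \<open>j\<close> by
  \<open>excess p i + excess p j\<close>, which is symmetric in \<open>i\<close> and
  \<open>j\<close>.\<close>

lemma reflect_braid:
  assumes "i \<noteq> j"
  shows "reflect i (reflect j (reflect i p)) = reflect j (reflect i (reflect j p))"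
proof -
  have *: "reflect i (reflect j (reflect i p)) $ k =
      p $ k - (if k = i \<or> k = j then excess p i + excess p j else 0)" if "i \<noteq> j" for i j k
    using that by (simp add: reflect_nth)
  show ?thesis
    using assms by (simp add: vec_eq_iff * disj_commute add.commute)
qed

abbreviation ascents :: "int^4 \<Rightarrow> 4 set" where
  "ascents p \<equiv> {i. excess p i < 0}"

abbreviation neutrals :: "int^4 \<Rightarrow> 4 set" where
  "neutrals p \<equiv> {i. excess p i = 0}"

abbreviation descents :: "int^4 \<Rightarrow> 4 set" where
  "descents p \<equiv> {i. excess p i > 0}"

lemma card_ascents_neutrals_descents:
  "card (ascents p) + card (neutrals p) + card (descents p) = 4"
proof -
  have "card (ascents p \<union> neutrals p \<union> descents p) = 
      card (ascents p) + card (neutrals p) + card (descents p)"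
    by (subst card_Un_disjoint; (subst card_Un_disjoint)?) auto
  moreover have "ascents p \<union> neutrals p \<union> descents p = UNIV"
    by auto
  ultimately show ?thesis
    by simp
qed

text \<open>Turns products of the form d * (d - 1) into cardinalities of sets of ordered pairs,
  ready for double counting.\<close>

lemma card_distinct_pairs:
  "int (card {(i, j). i \<noteq> j \<and> i \<in> I \<and> j \<in> I}) = int (card I) * (int (card I) - 1)"
  for I :: "'a::finite set"
proof -
  have "{(i, j). i \<noteq> j \<and> i \<in> I \<and> j \<in> I} = I \<times> I - (\<lambda>i. (i, i)) ` I"
    by auto
  moreover have "card (I \<times> I - (\<lambda>i. (i, i)) ` I) = card (I \<times> I) - card ((\<lambda>i. (i, i)) ` I)"
    by (rule card_Diff_subset) auto
  moreover have "card ((\<lambda>i. (i, i)) ` I) = card I"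
    by (rule card_image) (auto simp: inj_on_def)
  moreover have "card I \<le> card I * card I"
    by simp
  ultimately show ?thesis
    by (simp add: card_cartesian_product of_nat_diff algebra_simps)
qed

section \<open>Grading of the orbit by levels\<close>

text \<open>Captures the sign pattern of (0, x, x, x): nonnegative coordinates, one ascent
  \<open>a\<close> and three neutrals.\<close>

locale cusp =
  fixes r :: "int^4" and a :: 4
  assumes base_nonneg: "0 \<le> r $ i"
    and base_ascent: "excess r a < 0"
    and base_neutral: "i \<noteq> a \<Longrightarrow> excess r i = 0"
begin

primrec level :: "nat \<Rightarrow> (int^4) set" where
  "level 0 = {r}"
| "level (Suc n) = {reflect i p | i p. p \<in> level n \<and> excess p i < 0}"

declare level.simps(2) [simp del]

lemma level_SucE:
  assumes "p \<in> level (Suc n)"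
  obtains i q where "p = reflect i q" "q \<in> level n" "excess q i < 0"
  using assms by (auto simp: level.simps)

lemma base_no_descent: "excess r i \<le> 0"
  using base_ascent base_neutral[of i] by (cases "i = a") auto

lemma level_ascend: "p \<in> level n \<Longrightarrow> excess p i < 0 \<Longrightarrow> reflect i p \<in> level (Suc n)"
  by (auto simp: level.simps)

lemma level_descent_exists:
  assumes "p \<in> level (Suc n)"
  obtains i where "excess p i > 0"
  using assms that by (elim level_SucE) (metis excess_reflect_same neg_0_less_iff_less)

lemma finite_level [simp]: "finite (level n)"
proof (induction n)
  case (Suc n)
  have "level (Suc n) \<subseteq> (\<lambda>(i, p). reflect i p) ` (UNIV \<times> level n)"
    by (auto simp: level.simps)
  then show ?case
    by (rule finite_subset) (use Suc in auto)
qed auto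

text \<open>An ascent subtracts a negative excess, so coordinates only grow from \<open>r\<close>
  upwards.\<close>

lemma level_nonneg: "p \<in> level n \<Longrightarrow> 0 \<le> p $ i"
proof (induction n arbitrary: p)
  case 0
  then show ?case by (simp add: base_nonneg)
next
  case (Suc n)
  then obtain j q where q: "p = reflect j q" "q \<in> level n" "excess q j < 0"
    by (auto elim: level_SucE)
  with Suc.IH[of q] show ?case
    by (auto simp: reflect_nth intro: order.trans[OF less_imp_le])
qed

text \<open>Two descents \<open>i\<close>, \<open>j\<close> span a hexagon whose two downward paths end in the same point.\<close>

lemma level_descend:
  assumes "p \<in> level n" and "excess p i > 0"
  shows "n > 0 \<and> reflect i p \<in> level (n - 1)"
  using assms
proof (induction n arbitrary: p i rule: less_induct)
  case (less n)
  show ?case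
  proof (cases n)
    case 0
    then show ?thesis
      using less.prems base_no_descent[of i] by auto
  next
    case (Suc m)
    then obtain j q where q: "p = reflect j q" "q \<in> level m" "excess q j < 0"
      using less.prems by (auto elim: level_SucE)
    show ?thesis
    proof (cases "i = j")
      case True
      then show ?thesis using q Suc by simp
    next
      case False
      \<comment> \<open>\<open>u\<close> is the bottom of the hexagon, two descents below
        \<open>q\<close>. Two ascents along the other side lead from \<open>u\<close> to
        \<open>reflect i p\<close>, one level below \<open>p\<close>.\<close>
      define u where "u = reflect j (reflect i q)"
      have pos: "excess q i > 0" "excess p i > 0" "excess q i + excess q j > 0"
        using less.prems(2) False q(3) by (auto simp: q(1))
      have 1: "m > 0" "reflect i q \<in> level (m - 1)"
        using less.IH[of m q i] Suc q(2) pos by auto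
      have "excess (reflect i q) j > 0"
        using False pos by (simp add: add.commute)
      then have 2: "m - 1 > 0" "u \<in> level (m - 1 - 1)"
        using less.IH[of "m - 1" "reflect i q" j] Suc 1 by (auto simp: u_def)
      have "excess u i < 0" "excess (reflect i u) j < 0"
        using False pos q(3) by (auto simp: u_def)
      then have "reflect j (reflect i u) \<in> level (Suc (Suc (m - 1 - 1)))"
        using 2 level_ascend by blast
      moreover have "reflect j (reflect i u) = reflect i p"
        using False reflect_braid[of j i "reflect i q"] by (simp add: u_def q(1))
      moreover have "Suc (Suc (m - 1 - 1)) = n - 1"
        using Suc 1 2 by simp
      ultimately show ?thesis
        using Suc by simp
    qed
  qed
qed

text \<open>A descent of a common point lowers both indices by one. The induction ends at
  \<open>r\<close>, which has no descent, whereas every point of a higher level has one.\<close>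

lemma level_disjoint: "p \<in> level m \<Longrightarrow> p \<in> level n \<Longrightarrow> m = n"
proof (induction m arbitrary: p n)
  case 0
  show ?case
  proof (cases n)
    case (Suc k)
    then obtain i where "excess r i > 0"
      using 0 level_descent_exists[of p k] by auto
    then show ?thesis
      using base_no_descent[of i] by simp
  qed simp
next
  case (Suc m)
  then obtain i where i: "excess p i > 0"
    using level_descent_exists by blast
  then have "n > 0" "reflect i p \<in> level (n - 1)" "reflect i p \<in> level m"
    using Suc.prems level_descend[of p n i] level_descend[of p "Suc m" i] by auto
  then show ?case
    using Suc.IH[of "reflect i p" "n - 1"] by simp
qed

text \<open>Three excesses add up to \<open>-3\<close> times the fourth coordinate, which is nonnegative.\<close>

lemma level_no_three:
  assumes "p \<in> level n" "distinct [i, j, k]" "excess p i > 0" "excess p j \<ge> 0" "excess p k \<ge> 0"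
  shows False
proof -
  obtain l where l: "l \<notin> {i, j, k}"
    using card_mono[of "{i, j, k}" "UNIV :: 4 set"] assms(2) by fastforce
  have "card {i, j, k, l} = 4"
    using assms(2) l by auto
  then have "UNIV = {i, j, k, l}"
    using card_subset_eq[of UNIV "{i, j, k, l}"] by simp
  then have "(\<Sum>m\<in>UNIV. p $ m) = (\<Sum>m\<in>{i, j, k, l}. p $ m)"
    by simp
  also have "\<dots> = p $ i + p $ j + p $ k + p $ l"
  proof -
    have "i \<notin> {j, k, l}" "j \<notin> {k, l}" "k \<noteq> l"
      using assms(2) l by auto
    then show ?thesis
      by (simp add: add.assoc)
  qed
  finally have "(\<Sum>m\<in>UNIV. p $ m) = p $ i + p $ j + p $ k + p $ l" .
  then show False
    using assms level_nonneg[of p n l] by (simp add: excess_def)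
qed

text \<open>By \<open>level_no_three\<close>, at most one index besides a given descent has
  nonnegative excess.\<close>

lemma level_type:
  assumes "p \<in> level (Suc n)"
  shows "(card (descents p), card (neutrals p)) \<in> {(1, 0), (1, 1), (2, 0)}"
proof -
  obtain i where i: "excess p i > 0"
    using assms level_descent_exists by blast
  define N where "N = {j. excess p j \<ge> 0} - {i}"
  have "card N \<le> 1"
  proof (rule ccontr)
    assume "\<not> card N \<le> 1"
    then obtain j k where "j \<in> N" "k \<in> N" "j \<noteq> k"
      by (metis card_le_Suc0_iff_eq One_nat_def finite_class.finite_UNIV finite_subset subset_UNIV)
    then show False
      using level_no_three[OF assms, of i j k] i by (auto simp: N_def)
  qed
  moreover have "card (descents p) + card (neutrals p) = Suc (card N)"
  proof -
    have "card (descents p) + card (neutrals p) = card (descents p \<union> neutrals p)"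
      by (subst card_Un_disjoint) auto
    also have "descents p \<union> neutrals p = insert i N"
      using i by (auto simp: N_def)
    also have "card \<dots> = Suc (card N)"
      unfolding N_def by (intro card_insert_disjoint) auto
    finally show ?thesis .
  qed
  moreover have "card (descents p) > 0"
    using i by (auto simp: card_gt_0_iff)
  ultimately show ?thesis
    unfolding insert_iff prod.inject by linarith
qed

text \<open>Above level 0 a point has at most two descents and a descent with at most one neutral
  (\<open>level_type\<close>), so \<open>B\<close> is twice the number of points with two descents and
  \<open>Y\<close> is the number of points with a neutral.\<close>

definition S :: "nat \<Rightarrow> int" where
  "S n = int (card (level n))"

definition B :: "nat \<Rightarrow> int" where
  "B n = (\<Sum>p\<in>level n. int (card (descents p)) * (int (card (descents p)) - 1))"

definition Y :: "nat \<Rightarrow> int" where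
  "Y n = (\<Sum>p\<in>level n. int (card (descents p)) * int (card (neutrals p)))"

section \<open>Double counting between levels\<close>

text \<open>The label \<open>t\<close> is carried along unchanged, and \<open>f t\<close>,
  \<open>g t\<close> are mutually inverse on the points bearing it.\<close>

lemma double_count:
  fixes P Q :: "int^4 \<Rightarrow> 'i::finite set"
  assumes "\<And>p t. p \<in> level m \<Longrightarrow> t \<in> P p \<Longrightarrow> f t p \<in> level n \<and> t \<in> Q (f t p) \<and> g t (f t p) = p"
    and "\<And>q t. q \<in> level n \<Longrightarrow> t \<in> Q q \<Longrightarrow> g t q \<in> level m \<and> t \<in> P (g t q) \<and> f t (g t q) = q"
  shows "(\<Sum>p\<in>level m. int (card (P p))) = (\<Sum>q\<in>level n. int (card (Q q)))"
proof -
  have "bij_betw (\<lambda>(p, t). (f t p, t)) (SIGMA p:level m. P p) (SIGMA q:level n. Q q)"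
    by (rule bij_betw_byWitness[where f' = "\<lambda>(q, t). (g t q, t)"]) (use assms in auto)
  then have "card (SIGMA p:level m. P p) = card (SIGMA q:level n. Q q)"
    by (rule bij_betw_same_card)
  then show ?thesis
    by (simp flip: of_nat_sum)
qed

lemma sum_ascents: "(\<Sum>p\<in>level n. int (card (ascents p))) = (\<Sum>p\<in>level (Suc n). int (card (descents p)))"
proof (rule double_count[where f = reflect and g = reflect])
  fix q i assume "q \<in> level (Suc n)" "i \<in> descents q"
  then show "reflect i q \<in> level n \<and> i \<in> ascents (reflect i q) \<and> reflect i (reflect i q) = q"
    using level_descend[of q "Suc n" i] by simp
qed (auto intro: level_ascend)

text \<open>The excesses met on the way down are \<open>excess q i\<close>, the sum of both
  excesses, and \<open>excess q j\<close>, all positive.\<close>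

lemma two_descents:
  assumes "q \<in> level n" "i \<noteq> j" "excess q i > 0" "excess q j > 0"
  shows "n \<ge> 3 \<and> reflect i (reflect j (reflect i q)) \<in> level (n - 3)"
proof -
  have 1: "n > 0" "reflect i q \<in> level (n - 1)"
    using level_descend assms by auto
  have 2: "n - 1 > 0" "reflect j (reflect i q) \<in> level (n - 1 - 1)"
    using level_descend[OF 1(2), of j] assms by auto
  have "n - 1 - 1 > 0" "reflect i (reflect j (reflect i q)) \<in> level (n - 1 - 1 - 1)"
    using level_descend[OF 2(2), of i] assms by auto
  then show ?thesis
    by (auto simp: numeral_3_eq_3)
qed

text \<open>For fixed \<open>(i, j)\<close> the map \<open>f\<close> is an involution that exchanges
  the two excesses and flips their signs, so it serves in both directions.\<close>

lemma sum_ascent_pairs: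
  "(\<Sum>p\<in>level n. int (card (ascents p)) * (int (card (ascents p)) - 1)) = B (n + 3)"
  unfolding B_def card_distinct_pairs[symmetric]
proof -
  define f where "f = (\<lambda>(i, j) p. reflect i (reflect j (reflect i p)))"
  show "(\<Sum>p\<in>level n. int (card {(i, j). i \<noteq> j \<and> i \<in> ascents p \<and> j \<in> ascents p})) =
      (\<Sum>q\<in>level (n + 3). int (card {(i, j). i \<noteq> j \<and> i \<in> descents q \<and> j \<in> descents q}))"
  proof (rule double_count[where f = f and g = f])
    fix p t assume p: "p \<in> level n" and t: "t \<in> {(i, j). i \<noteq> j \<and> i \<in> ascents p \<and> j \<in> ascents p}"
    then obtain i j where ij: "t = (i, j)" "i \<noteq> j" "excess p i < 0" "excess p j < 0"
      by auto
    then have "reflect i p \<in> level (Suc n)"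
      using p level_ascend by blast
    then have "reflect j (reflect i p) \<in> level (Suc (Suc n))"
      by (rule level_ascend) (use ij in auto)
    then have "reflect i (reflect j (reflect i p)) \<in> level (Suc (Suc (Suc n)))"
      by (rule level_ascend) (use ij in auto)
    then show "f t p \<in> level (n + 3) \<and>
        t \<in> {(i, j). i \<noteq> j \<and> i \<in> descents (f t p) \<and> j \<in> descents (f t p)} \<and> f t (f t p) = p"
      using ij by (simp add: numeral_3_eq_3 f_def)
  next
    fix q t assume q: "q \<in> level (n + 3)" and t: "t \<in> {(i, j). i \<noteq> j \<and> i \<in> descents q \<and> j \<in> descents q}"
    then obtain i j where ij: "t = (i, j)" "i \<noteq> j" "excess q i > 0" "excess q j > 0"
      by auto
    then show "f t q \<in> level n \<and>
        t \<in> {(i, j). i \<noteq> j \<and> i \<in> ascents (f t q) \<and> j \<in> ascents (f t q)} \<and> f t (f t q) = q"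
      using two_descents[OF q ij(2-4)] by (simp add: f_def)
  qed
qed

text \<open>Reflecting in the descent \<open>j\<close> gives the neutral \<open>i\<close> the
  positive excess \<open>excess q j\<close>, so \<open>i\<close> becomes a descent.\<close>

lemma descent_and_neutral:
  assumes "q \<in> level n" "excess q i = 0" "excess q j > 0"
  shows "n \<ge> 2 \<and> reflect i (reflect j q) \<in> level (n - 2)"
proof -
  have 1: "n > 0" "reflect j q \<in> level (n - 1)"
    using level_descend assms by auto
  have "i \<noteq> j"
    using assms by auto
  then have "n - 1 > 0" "reflect i (reflect j q) \<in> level (n - 1 - 1)"
    using level_descend[OF 1(2), of i] assms by auto
  then show ?thesis
    by (auto simp: numeral_2_eq_2)
qed

text \<open>Climbing by the ascent and then by the former neutral turns the first index into a
  neutral and the second into a descent, hence the swapped order of factors above.\<close>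

lemma sum_ascents_neutrals:
  "(\<Sum>p\<in>level n. int (card (ascents p)) * int (card (neutrals p))) = Y (n + 2)"
proof -
  have "(\<Sum>p\<in>level n. int (card (ascents p \<times> neutrals p))) =
      (\<Sum>q\<in>level (n + 2). int (card (neutrals q \<times> descents q)))"
  proof (rule double_count[where f = "\<lambda>t p. reflect (snd t) (reflect (fst t) p)"
        and g = "\<lambda>t p. reflect (fst t) (reflect (snd t) p)"])
    fix p t assume p: "p \<in> level n" and t: "t \<in> ascents p \<times> neutrals p"
    then have ij: "fst t \<noteq> snd t" "excess p (fst t) < 0" "excess p (snd t) = 0"
      by auto
    then have "reflect (fst t) p \<in> level (Suc n)"
      using p level_ascend by blast
    then have "reflect (snd t) (reflect (fst t) p) \<in> level (Suc (Suc n))"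
      by (rule level_ascend) (use ij in auto)
    then show "reflect (snd t) (reflect (fst t) p) \<in> level (n + 2) \<and>
      t \<in> neutrals (reflect (snd t) (reflect (fst t) p)) \<times> descents (reflect (snd t) (reflect (fst t) p)) \<and>
      reflect (fst t) (reflect (snd t) (reflect (snd t) (reflect (fst t) p))) = p"
      using ij by (simp add: mem_Times_iff)
  next
    fix q t assume q: "q \<in> level (n + 2)" and t: "t \<in> neutrals q \<times> descents q"
    then have ij: "fst t \<noteq> snd t" "excess q (fst t) = 0" "excess q (snd t) > 0"
      by auto
    then show "reflect (fst t) (reflect (snd t) q) \<in> level n \<and>
      t \<in> ascents (reflect (fst t) (reflect (snd t) q)) \<times> neutrals (reflect (fst t) (reflect (snd t) q)) \<and>
      reflect (snd t) (reflect (fst t) (reflect (fst t) (reflect (snd t) q))) = q"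
      using descent_and_neutral[OF q ij(2,3)] by (simp add: mem_Times_iff)
  qed
  then show ?thesis
    by (simp add: Y_def card_cartesian_product mult.commute)
qed

lemma B_small: "n < 3 \<Longrightarrow> B n = 0"
  unfolding B_def card_distinct_pairs[symmetric]
  using two_descents[of _ n] by (intro sum.neutral) (auto simp: card_eq_0_iff)

lemma Y_small: "n < 2 \<Longrightarrow> Y n = 0"
  unfolding Y_def
  using descent_and_neutral[of _ n] by (intro sum.neutral) (auto simp: card_eq_0_iff)

section \<open>Recurrences for \<open>S\<close>, \<open>B\<close> and \<open>Y\<close>\<close>

text \<open>On the three types of \<open>level_type\<close> each count is a linear combination of 1,
  \<open>d * (d - 1)\<close> and \<open>d * z\<close>, whose sums over a level are \<open>S\<close>,
  \<open>B\<close> and \<open>Y\<close>.\<close>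

lemma local_counts:
  assumes "p \<in> level (Suc n)"
  defines "d \<equiv> int (card (descents p))" and "z \<equiv> int (card (neutrals p))"
    and "u \<equiv> int (card (ascents p))"
  shows "2 * d = 2 + d * (d - 1)"
    and "2 * u = 6 - d * (d - 1) - 2 * (d * z)"
    and "u * (u - 1) = 6 - 2 * (d * (d - 1)) - 4 * (d * z)"
    and "u * z = 2 * (d * z)"
proof -
  have u: "u = 4 - d - z"
    using card_ascents_neutrals_descents[of p] by (simp add: d_def z_def u_def)
  have "(d, z) \<in> {(1, 0), (1, 1), (2, 0)}"
    using level_type[OF assms(1)] unfolding d_def z_def
    by (simp only: insert_iff prod.inject empty_iff) linarith
  then show "2 * d = 2 + d * (d - 1)"
    and "2 * u = 6 - d * (d - 1) - 2 * (d * z)"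
    and "u * (u - 1) = 6 - 2 * (d * (d - 1)) - 4 * (d * z)"
    and "u * z = 2 * (d * z)"
    unfolding u by auto
qed

lemma sum_descents:
  "2 * (\<Sum>p\<in>level (Suc n). int (card (descents p))) = 2 * S (Suc n) + B (Suc n)"
proof -
  have "2 * (\<Sum>p\<in>level (Suc n). int (card (descents p))) =
      (\<Sum>p\<in>level (Suc n). 2 + int (card (descents p)) * (int (card (descents p)) - 1))"
    unfolding sum_distrib_left by (intro sum.cong refl local_counts(1))
  then show ?thesis
    by (simp add: sum.distrib S_def B_def)
qed

text \<open>Each side is twice the number of ascending steps between the two levels, counted at the
  upper ends on the left and at the lower ends on the right.\<close>

lemma S_rec: "2 * S (Suc (Suc n)) + B (Suc (Suc n)) = 6 * S (Suc n) - B (Suc n) - 2 * Y (Suc n)"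
proof -
  have "2 * S (Suc (Suc n)) + B (Suc (Suc n)) = 2 * (\<Sum>p\<in>level (Suc n). int (card (ascents p)))"
    using sum_descents[of "Suc n"] by (simp add: sum_ascents)
  also have "\<dots> = (\<Sum>p\<in>level (Suc n). 6 - int (card (descents p)) * (int (card (descents p)) - 1)
      - 2 * (int (card (descents p)) * int (card (neutrals p))))"
    unfolding sum_distrib_left by (intro sum.cong refl local_counts(2))
  also have "\<dots> = 6 * S (Suc n) - B (Suc n) - 2 * Y (Suc n)"
    by (simp add: sum_subtractf S_def B_def Y_def sum_distrib_left)
  finally show ?thesis .
qed

lemma B_rec: "B (Suc n + 3) = 6 * S (Suc n) - 2 * B (Suc n) - 4 * Y (Suc n)"
proof -
  have "B (Suc n + 3) = (\<Sum>p\<in>level (Suc n). 6 - 2 * (int (card (descents p)) * (int (card (descents p)) - 1))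
      - 4 * (int (card (descents p)) * int (card (neutrals p))))"
    unfolding sum_ascent_pairs[symmetric] by (intro sum.cong refl local_counts(3))
  also have "\<dots> = 6 * S (Suc n) - 2 * B (Suc n) - 4 * Y (Suc n)"
    by (simp add: sum_subtractf S_def B_def Y_def sum_distrib_left)
  finally show ?thesis .
qed

lemma Y_rec: "Y (Suc n + 2) = 2 * Y (Suc n)"
proof -
  have "Y (Suc n + 2) = (\<Sum>p\<in>level (Suc n). 2 * (int (card (descents p)) * int (card (neutrals p))))"
    unfolding sum_ascents_neutrals[symmetric] by (intro sum.cong refl local_counts(4))
  then show ?thesis
    by (simp add: Y_def sum_distrib_left)
qed

section \<open>Starting values and growth of the level sizes\<close>

lemma ascents_base: "ascents r = {a}"
  using base_ascent base_neutral by force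

text \<open>Level 0 lies outside \<open>local_counts\<close>, so the starting values are read off
  from the single ascent and three neutrals of \<open>r\<close>.\<close>

lemma S_1: "S 1 = 1"
  using sum_descents[of 0] sum_ascents[of 0] B_small[of 1] by (simp add: ascents_base)

lemma B_3: "B 3 = 0"
  using sum_ascent_pairs[of 0] by (simp add: ascents_base)

lemma Y_2: "Y 2 = 3"
proof -
  have "neutrals r = UNIV - {a}"
    using base_ascent base_neutral by force
  then show ?thesis
    using sum_ascents_neutrals[of 0] by (simp add: ascents_base card_Diff_subset numeral_2_eq_2)
qed

text \<open>Eliminating \<open>B\<close> and \<open>Y\<close>, the defect
  \<open>I n = S (n + 2) - S (n + 1) - 3 * S n\<close> satisfies \<open>I (n + 3) = 3 * I (n + 1) - 2 * I n\<close>,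
  and it vanishes for \<open>n = 1, 2, 3\<close>.\<close>

lemma S_fib: "S (Suc (Suc (Suc n))) = S (Suc (Suc n)) + 3 * S (Suc n)"
proof (induction n rule: less_induct)
  case (less n)
  have S: "2 * S (Suc (Suc k)) = 6 * S (Suc k) - B (Suc k) - B (Suc (Suc k)) - 2 * Y (Suc k)" for k
    using S_rec[of k] by simp
  have B: "B (Suc (Suc (Suc (Suc k)))) = 6 * S (Suc k) - 2 * B (Suc k) - 4 * Y (Suc k)" for k
    using B_rec[of k] by (simp add: numeral_3_eq_3)
  have Y: "Y (Suc (Suc (Suc k))) = 2 * Y (Suc k)" for k
    using Y_rec[of k] by (simp add: numeral_2_eq_2)
  have base: "S (Suc 0) = 1" "B (Suc 0) = 0" "B (Suc (Suc 0)) = 0" "B (Suc (Suc (Suc 0))) = 0"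
    "Y (Suc 0) = 0" "Y (Suc (Suc 0)) = 3"
    using S_1 B_3 Y_2 B_small[of 1] B_small[of 2] Y_small[of 1] by (simp_all add: eval_nat_numeral)
  show ?case
  proof (cases "n < 3")
    case True
    then have "n = 0 \<or> n = 1 \<or> n = 2"
      by auto
    then show ?thesis
      using base S[of 0] S[of 1] S[of 2] S[of 3] B[of 0] B[of 1] B[of 2] Y[of 0] Y[of 1]
      by (auto simp: eval_nat_numeral)
  next
    case False
    then obtain k where k: "n = Suc (Suc (Suc k))"
      using le_Suc_ex[of 3 n] by (auto simp: numeral_3_eq_3)
    \<comment> \<open>The induction hypotheses say that the defects \<open>I (k + 1)\<close> and
      \<open>I (k + 2)\<close> vanish; the goal is \<open>I (k + 4) = 0\<close>.\<close>
    show ?thesis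
      using less.IH[of k] less.IH[of "Suc k"]
        S[of k] S[of "Suc k"] S[of "Suc (Suc k)"] S[of "Suc (Suc (Suc k))"] S[of "Suc (Suc (Suc (Suc k)))"]
        B[of k] B[of "Suc k"] B[of "Suc (Suc k)"] Y[of k] Y[of "Suc k"] Y[of "Suc (Suc k)"]
      unfolding k by simp
  qed
qed

text \<open>Powers of \<open>lam\<close> obey the recurrence of \<open>S\<close>, whose coefficients
  are positive, so both bounds propagate from \<open>S 1 = 1\<close> and \<open>S 2 = 3\<close>. At
  level 1 the factor 1/3 comes from \<open>lam \<le> 3\<close>.\<close>

lemma S_bounds:
  fixes lam :: real
  assumes "lam\<^sup>2 = lam + 3" "lam \<ge> 2" "lam \<le> 3"
  shows "lam ^ Suc n / 3 \<le> S (Suc n) \<and> S (Suc n) \<le> lam ^ Suc n"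
proof (induction n rule: less_induct)
  case (less n)
  have S1: "S (Suc 0) = 1"
    using S_1 by simp
  have S2: "S (Suc (Suc 0)) = 3"
    using S_rec[of 0] S1 B_small[of 1] B_small[of 2] Y_small[of 1] by (simp add: numeral_2_eq_2)
  consider "n = 0" | "n = 1" | k where "n = Suc (Suc k)"
    by (metis One_nat_def not0_implies_Suc)
  then show ?case
  proof cases
    case 1
    then show ?thesis using S1 assms by simp
  next
    case 2
    then show ?thesis using S2 assms by (simp flip: power2_eq_square)
  next
    case 3
    have "lam ^ Suc n = lam ^ Suc (Suc k) + 3 * lam ^ Suc k"
    proof -
      have "lam ^ Suc n = lam\<^sup>2 * lam ^ Suc k"
        by (simp add: 3 power2_eq_square)
      then show ?thesis
        unfolding assms(1) by (simp add: algebra_simps)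
    qed
    moreover have "S (Suc n) = S (Suc (Suc k)) + 3 * S (Suc k)"
      using S_fib[of k] 3 by simp
    ultimately show ?thesis
      using less.IH[of k] less.IH[of "Suc k"] 3 by (simp del: power_Suc)
  qed
qed

section \<open>Unions of levels\<close>

lemma card_levels: "int (card (\<Union>k\<le>n. level k)) = (\<Sum>k\<le>n. S k)"
  using level_disjoint by (subst card_UN_disjoint) (auto simp: S_def)

lemma levels_reflect:
  assumes "p \<in> (\<Union>k\<le>n. level k)"
  shows "reflect i p \<in> (\<Union>k\<le>Suc n. level k)"
proof -
  obtain k where k: "k \<le> n" "p \<in> level k"
    using assms by auto
  consider "excess p i < 0" | "excess p i = 0" | "excess p i > 0"
    by linarith
  then show ?thesis
  proof cases
    case 1
    then show ?thesis
      using level_ascend[OF k(2)] k(1) by blast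
  next
    case 2
    then show ?thesis
      using k reflect_neutral[of p i] by (auto intro: le_SucI)
  next
    case 3
    then have "reflect i p \<in> level (k - 1)"
      using level_descend k by blast
    moreover have "k - 1 \<le> Suc n"
      using k by simp
    ultimately show ?thesis
      by blast
  qed
qed

end

section \<open>Matrix words as chains of reflections\<close>

lemma generator_mult_vec:
  "S1 *v p = reflect 1 p" "S2 *v p = reflect 2 p" "S3 *v p = reflect 3 p" "S4 *v p = reflect 4 p"
  by (simp_all add: S1_def S2_def S3_def S4_def vec_eq_iff forall_4 matrix_vector_mult_def sum_4
      vector_4_nth reflect_nth excess_def)

lemma generator_is_reflect: "M \<in> triangle_generators \<Longrightarrow> \<exists>i. \<forall>p. M *v p = reflect i p"
  by (auto simp: triangle_generators_def generator_mult_vec)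

lemma reflect_is_generator: "\<exists>M\<in>triangle_generators. \<forall>p. M *v p = reflect i p"
  using exhaust_4[of i] by (auto simp: triangle_generators_def generator_mult_vec)

lemma m_inv_generator: "M \<in> triangle_generators \<Longrightarrow> m_inv GL4Z M = M"
  using triangle_generators_GL4Z triangle_generators_involution
  by (intro group.inv_equality[OF group_GL4Z]) (auto simp: triangle_generators_def GL4Z_def)

lemma foldr_matrix_mult_append:
  "foldr (**) (us @ vs) (mat 1) = foldr (**) us (mat 1) ** foldr (**) vs (mat 1 :: int^4^4)"
  by (induction us) (auto simp: matrix_mul_assoc)

text \<open>The generators are involutions, so admitting inverses in \<open>word_length\<close> adds
  no new letters.\<close>

lemma word_ball_eq:
  "word_ball n = {foldr (**) ws (mat 1) | ws. set ws \<subseteq> triangle_generators \<and> length ws \<le> n}"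
proof -
  have inv: "triangle_generators \<union> m_inv GL4Z ` triangle_generators = triangle_generators"
    using m_inv_generator by auto
  have length: "word_length GL4Z triangle_generators w =
      (LEAST k. \<exists>ws. set ws \<subseteq> triangle_generators \<and> length ws = k \<and> foldr (**) ws (mat 1) = w)" for w
    unfolding word_length_def inv by (simp add: GL4Z_def)
  have in_group: "foldr (**) ws (mat 1) \<in> triangle_group" if "set ws \<subseteq> triangle_generators" for ws
    using that
  proof (induction ws)
    case Nil
    then show ?case
      using generate.one[of GL4Z triangle_generators] by (simp add: triangle_group_def GL4Z_def)
  next
    case (Cons M ws)
    then have "M \<in> generate GL4Z triangle_generators"
      "foldr (**) ws (mat 1) \<in> generate GL4Z triangle_generators"
      by (auto simp: triangle_group_def intro: generate.incl)
    from generate.eng[OF this] show ?case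
      by (simp add: triangle_group_def GL4Z_def)
  qed
  have word: "\<exists>ws. set ws \<subseteq> triangle_generators \<and> foldr (**) ws (mat 1) = w" if "w \<in> triangle_group" for w
    using that unfolding triangle_group_def
  proof (induction w rule: generate.induct)
    case one
    show ?case
      by (rule exI[of _ "[]"]) (simp add: GL4Z_def)
  next
    case (incl M)
    then show ?case
      by (intro exI[of _ "[M]"]) simp
  next
    case (inv M)
    then show ?case
      by (intro exI[of _ "[M]"]) (simp add: m_inv_generator)
  next
    case (eng v w)
    then obtain us vs where "set us \<subseteq> triangle_generators" "foldr (**) us (mat 1) = v"
      "set vs \<subseteq> triangle_generators" "foldr (**) vs (mat 1) = w"
      by auto
    then show ?case
      by (intro exI[of _ "us @ vs"]) (simp add: foldr_matrix_mult_append GL4Z_def del: foldr_append)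
  qed
  show ?thesis
  proof (intro equalityI subsetI)
    fix w assume w: "w \<in> word_ball n"
    \<comment> \<open>Existence of some word ensures that the \<open>LEAST\<close> in
      \<open>word_length\<close> is attained.\<close>
    then have "\<exists>k ws. set ws \<subseteq> triangle_generators \<and> length ws = k \<and> foldr (**) ws (mat 1) = w"
      using word by (auto simp: word_ball_def)
    from LeastI_ex[OF this] show "w \<in> {foldr (**) ws (mat 1) | ws. set ws \<subseteq> triangle_generators \<and> length ws \<le> n}"
      using w unfolding word_ball_def length[symmetric] by auto
  next
    fix w assume "w \<in> {foldr (**) ws (mat 1) | ws. set ws \<subseteq> triangle_generators \<and> length ws \<le> n}"
    then obtain ws where ws: "w = foldr (**) ws (mat 1)" "set ws \<subseteq> triangle_generators" "length ws \<le> n"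
      by auto
    then have "word_length GL4Z triangle_generators w \<le> length ws"
      unfolding length by (intro Least_le) auto
    then show "w \<in> word_ball n"
      using ws in_group by (simp add: word_ball_def)
  qed
qed

text \<open>A letter raises the level by at most one; conversely, an ascending path to level
  \<open>k\<close> spells a word of length \<open>k\<close>.\<close>

lemma (in cusp) word_ball_orbit: "(\<lambda>w. w *v r) ` word_ball n = (\<Union>k\<le>n. level k)"
proof (intro equalityI subsetI)
  have "foldr (**) ws (mat 1) *v r \<in> (\<Union>k\<le>length ws. level k)" if "set ws \<subseteq> triangle_generators" for ws
    using that
  proof (induction ws)
    case (Cons M ws)
    obtain i where "\<And>p. M *v p = reflect i p"
      using Cons.prems generator_is_reflect[of M] by auto
    then have "foldr (**) (M # ws) (mat 1) *v r = reflect i (foldr (**) ws (mat 1) *v r)"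
      by (simp flip: matrix_vector_mul_assoc)
    then show ?case
      using Cons levels_reflect[of _ "length ws" i] by simp
  qed simp
  moreover fix p assume "p \<in> (\<lambda>w. w *v r) ` word_ball n"
  ultimately show "p \<in> (\<Union>k\<le>n. level k)"
    unfolding word_ball_eq by (fastforce intro: order.trans)
next
  have "\<exists>ws. set ws \<subseteq> triangle_generators \<and> length ws = k \<and> foldr (**) ws (mat 1) *v r = p"
    if "p \<in> level k" for k p
    using that
  proof (induction k arbitrary: p)
    case (Suc k)
    then obtain i q where q: "p = reflect i q" "q \<in> level k"
      by (auto elim: level_SucE)
    then obtain ws where ws: "set ws \<subseteq> triangle_generators" "length ws = k" "foldr (**) ws (mat 1) *v r = q"
      using Suc.IH by blast
    obtain M where "M \<in> triangle_generators" "\<And>p. M *v p = reflect i p"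
      using reflect_is_generator by blast
    then show ?case
      using ws q by (intro exI[of _ "M # ws"]) (simp flip: matrix_vector_mul_assoc)
  qed simp
  moreover fix p assume "p \<in> (\<Union>k\<le>n. level k)"
  ultimately obtain ws where "set ws \<subseteq> triangle_generators" "length ws \<le> n" "foldr (**) ws (mat 1) *v r = p"
    by (metis UN_E atMost_iff)
  then show "p \<in> (\<lambda>w. w *v r) ` word_ball n"
    unfolding word_ball_eq by blast
qed

section \<open>Exponential bounds for the orbit balls\<close>

theorem theorem6:
  fixes x :: int and r :: "int^4" and lam :: real
  assumes "x > 0"
    and "r = vector [0, x, x, x]"
    and "lam = (1 + sqrt 13) / 2"
  shows "\<exists>c1 c2 :: real. c1 > 0 \<and> c2 > 0 \<and>
    (\<forall>n::nat. n \<ge> 1 \<longrightarrow>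
      c1 * lam ^ n / (real n)\<^sup>2 \<le> real (card ((\<lambda>w. w *v r) ` word_ball n)) \<and>
      real (card ((\<lambda>w. w *v r) ` word_ball n)) \<le> c2 * lam ^ n)"
proof -
  \<comment> \<open>The coordinates of \<open>r\<close> sum to 3x, so the excess is -3x at index 1
    and 0 elsewhere.\<close>
  interpret cusp r 1
  proof
    show "0 \<le> r $ i" for i
      using exhaust_4[of i] assms(1,2) by (auto simp: vector_4_nth)
    show "excess r 1 < 0"
      using assms(1,2) by (simp add: excess_def sum_4 vector_4_nth)
    show "excess r i = 0" if "i \<noteq> 1" for i
      using exhaust_4[of i] that assms(2) by (auto simp: excess_def sum_4 vector_4_nth)
  qed
  have "3 \<le> sqrt 13" "sqrt 13 \<le> 5"
    by (auto intro: real_le_rsqrt real_le_lsqrt)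
  then have lam: "lam\<^sup>2 = lam + 3" "2 \<le> lam" "lam \<le> 3"
    by (auto simp: assms(3) power2_eq_square field_simps)
  have S: "lam ^ n / 3 \<le> S n" "S n \<le> lam ^ n" if "n \<ge> 1" for n
    using S_bounds[OF lam, of "n - 1"] that by auto
  have S0: "S 0 = 1"
    by (simp add: S_def)
  have card: "real (card ((\<lambda>w. w *v r) ` word_ball n)) = (\<Sum>k\<le>n. real_of_int (S k))" for n
    using card_levels[of n] unfolding word_ball_orbit by (metis of_int_of_nat_eq of_int_sum)
  \<comment> \<open>The constant 2 survives the induction because \<open>lam \<ge> 2\<close> lets
    the new term absorb the previous bound.\<close>
  have upper: "(\<Sum>k\<le>n. real_of_int (S k)) \<le> 2 * lam ^ n" for n
  proof (induction n)
    case (Suc n)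
    have "2 * lam ^ n \<le> lam ^ Suc n"
      using lam by simp
    then show ?case
      using Suc S(2)[of "Suc n"] by simp
  qed (simp add: S0)
  \<comment> \<open>The top level alone suffices, and division by the square of \<open>n\<close>
    only weakens its bound.\<close>
  have lower: "1 / 3 * lam ^ n / (real n)\<^sup>2 \<le> (\<Sum>k\<le>n. real_of_int (S k))" if "n \<ge> 1" for n
  proof -
    have "1 / 3 * lam ^ n / (real n)\<^sup>2 \<le> 1 / 3 * lam ^ n / 1"
      using that lam by (intro divide_left_mono) auto
    also have "\<dots> \<le> S n"
      using S(1)[OF that] by simp
    also have "\<dots> \<le> (\<Sum>k\<le>n. real_of_int (S k))"
      by (rule member_le_sum) (auto simp: S_def)
    finally show ?thesis .
  qed
  show ?thesis
    unfolding card using upper lower by (intro exI[of _ "1/3"] exI[of _ 2]) auto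
qed

end
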